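(* Let $K$ be a field of characteristic $\neq 2$ and let $\mathcal{E}=I_1\oplus I_2$ be a decomposable power-associative nil evolution $K$-algebra, where $I_1,I_2$ are nonzero ideals of $\mathcal{E}$. Let $d:\mathcal{E}\to\mathcal{E}$ be a derivation. Then $d$ is determined by a unique quadruple $(f_d,g_d,\ell_d,k_d)$ of linear maps $f_d\in \mathrm{End}(I_1)$, $g_d\in\mathrm{End}(I_2)$, $\ell_d\in\mathrm{Hom}(I_1,I_2)$, $k_d\in\mathrm{Hom}(I_2,I_1)$ satisfying: (i) $d(x_1)=f_d(x_1)+\ell_d(x_1)$ for all $x_1\in I_1$; (ii) $d(x_2)=g_d(x_2)+k_d(x_2)$ for all $x_2\in I_2$; (iii) $f_d\in\mathfrak{D}(I_1)$; (iv) $g_d\in\mathfrak{D}(I_2)$; (v) $\ell_d\in\mathrm{Hom}^0(I_1,I_2)=\{h\in\mathrm{Hom}(I_1,I_2)\mid h(I_1^2)=0 \text{ and } h(I_1)\subseteq \mathrm{ann}(I_2)\}$; (vi) $k_d\in\mathrm{Hom}^0(I_2,I_1)=\{h\in\mathrm{Hom}(I_2,I_1)\mid h(I_2^2)=0 \text{ and } h(I_2)\subseteq \mathrm{ann}(I_1)\}$.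
   Context: An evolution $K$-algebra is a finite-dimensional commutative (not necessarily associative) $K$-algebra having a basis $\{e_1,\dots,e_n\}$ (a natural basis) with $e_ie_j=0$ for $i\ne j$. It is power-associative if every subalgebra generated by one element is associative, and nil if for every $a$ some power $a^m$ is $0$ ($a^1=a$, $a^{k+1}=a^ka$). An algebra is decomposable if it is the direct sum of two nonzero ideals. A derivation of an algebra $A$ is a linear map $d:A\to A$ with $d(uv)=ud(v)+d(u)v$; $\mathfrak{D}(A)$ is the Lie algebra of derivations of $A$ with $[d,d']=d\circ d'-d'\circ d$. $\mathrm{Hom}$ and $\mathrm{End}$ denote $K$-linear maps. $I^2$ is the span of all products of two elements of $I$, and $\mathrm{ann}(I)=\{x\in I: xI=0\}$. *)

theory Defs
  imports Complex_Main "HOL-Library.FuncSet"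
begin

text \<open>
  The carrier of the algebra is a whole type; \<open>scale\<close> is the scalar multiplication and
  \<open>mult\<close> the (not necessarily associative) product.  Ideals are subsets of that type.
\<close>

locale comm_algebra = vector_space scale
  for scale :: "'k::field \<Rightarrow> 'e::ab_group_add \<Rightarrow> 'e" +
  fixes mult :: "'e \<Rightarrow> 'e \<Rightarrow> 'e"  (infixl "\<star>" 70)
  assumes mult_commute: "x \<star> y = y \<star> x"
    and mult_add_left: "(x + y) \<star> z = x \<star> z + y \<star> z"
    and mult_scale_left: "scale c x \<star> y = scale c (x \<star> y)"
begin

definition natural_basis :: "'e set \<Rightarrow> bool" where
  "natural_basis B \<longleftrightarrow> finite B \<and> independent B \<and> span B = UNIV \<and>
     (\<forall>e\<in>B. \<forall>e'\<in>B. e \<noteq> e' \<longrightarrow> e \<star> e' = 0)"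

definition subalgebra :: "'e set \<Rightarrow> bool" where
  "subalgebra S \<longleftrightarrow> subspace S \<and> (\<forall>x\<in>S. \<forall>y\<in>S. x \<star> y \<in> S)"

definition power_associative :: bool where
  "power_associative \<longleftrightarrow>
     (\<forall>a. \<forall>x \<in> subalgebra hull {a}. \<forall>y \<in> subalgebra hull {a}. \<forall>z \<in> subalgebra hull {a}.
        (x \<star> y) \<star> z = x \<star> (y \<star> z))"

text \<open>The algebra need not have a unit, so \<open>pow a m\<close> is meaningful only for \<open>m \<ge> 1\<close>:
  \<open>pow a 1 = a\<close> and \<open>pow a (m + 1) = pow a m \<star> a\<close>.\<close>

definition pow :: "'e \<Rightarrow> nat \<Rightarrow> 'e" where
  "pow a m = ((\<lambda>x. x \<star> a) ^^ (m - 1)) a"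

definition nil :: bool where
  "nil \<longleftrightarrow> (\<forall>a. \<exists>m\<ge>1. pow a m = 0)"

text \<open>One-sided closure suffices because the product is commutative.\<close>

definition ideal :: "'e set \<Rightarrow> bool" where
  "ideal I \<longleftrightarrow> subspace I \<and> (\<forall>x\<in>I. \<forall>y. x \<star> y \<in> I)"

definition direct_sum :: "'e set \<Rightarrow> 'e set \<Rightarrow> bool" where
  "direct_sum U V \<longleftrightarrow> {u + v |u v. u \<in> U \<and> v \<in> V} = UNIV \<and> U \<inter> V = {0}"

text \<open>Linear maps between subspaces are represented by functions taking the value
  \<open>undefined\<close> outside their domain (\<open>\<rightarrow>\<^sub>E\<close>), so that HOL equality is equality of maps.
  For domain \<open>UNIV\<close> this imposes nothing.\<close>

definition Hom :: "'e set \<Rightarrow> 'e set \<Rightarrow> ('e \<Rightarrow> 'e) set" where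
  "Hom U V = {h \<in> U \<rightarrow>\<^sub>E V. (\<forall>x\<in>U. \<forall>y\<in>U. h (x + y) = h x + h y) \<and>
                          (\<forall>c. \<forall>x\<in>U. h (scale c x) = scale c (h x))}"

abbreviation End :: "'e set \<Rightarrow> ('e \<Rightarrow> 'e) set" where
  "End U \<equiv> Hom U U"

definition derivations :: "'e set \<Rightarrow> ('e \<Rightarrow> 'e) set" where
  "derivations A = {d \<in> End A. \<forall>u\<in>A. \<forall>v\<in>A. d (u \<star> v) = u \<star> d v + d u \<star> v}"

definition square :: "'e set \<Rightarrow> 'e set" where
  "square I = span {x \<star> y |x y. x \<in> I \<and> y \<in> I}"

definition ann :: "'e set \<Rightarrow> 'e set" where
  "ann I = {x \<in> I. \<forall>y\<in>I. x \<star> y = 0}"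

definition Hom0 :: "'e set \<Rightarrow> 'e set \<Rightarrow> ('e \<Rightarrow> 'e) set" where
  "Hom0 U V = {h \<in> Hom U V. (\<forall>x \<in> square U. h x = 0) \<and> h ` U \<subseteq> ann V}"

lemma Hom_UNIV: "Hom UNIV UNIV = {h. Vector_Spaces.linear scale scale h}"
  by (auto simp: Hom_def Vector_Spaces.linear_def module_hom_def module_hom_axioms_def
      module_axioms vector_space_axioms)

end

locale evolution_algebra = comm_algebra +
  assumes ex_natural_basis: "\<exists>B. natural_basis B"

end

theory Submission
  imports Defs
begin

text \<open>
  The four maps are the blocks of \<open>d\<close> with respect to \<open>I1 \<oplus> I2\<close>, which settles existence as
  linear maps and uniqueness.  Everything else rests on \<open>I1 \<star> I2 \<subseteq> I1 \<inter> I2 = {0}\<close>.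
  Differentiating \<open>x \<star> y = 0\<close> for \<open>x \<in> I1\<close>, \<open>y \<in> I2\<close> gives \<open>x \<star> d y + d x \<star> y = 0\<close>, with the
  first summand in \<open>I1\<close> and the second in \<open>I2\<close>, so both vanish; the second one says that the
  \<open>I2\<close>-component of \<open>d x\<close> annihilates \<open>I2\<close> (\<open>off_diagonal_block_annihilates\<close>).
  Differentiating a product of two elements of \<open>I1\<close> gives
  an element of \<open>I1\<close> again, so the off-diagonal block kills \<open>I1\<^sup>2\<close>, and comparing
  \<open>I1\<close>-components shows that the diagonal block satisfies the Leibniz rule
  (\<open>off_diagonal_block_Hom0\<close>, \<open>diagonal_block_derivation\<close>).  The block on \<open>I2\<close> is obtained by
  exchanging the ideals.
\<close>

section \<open>Components with respect to a direct sum of subspaces\<close>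

context comm_algebra
begin

definition component :: "'e set \<Rightarrow> 'e set \<Rightarrow> 'e \<Rightarrow> 'e" where
  "component U V x = (THE u. u \<in> U \<and> x - u \<in> V)"

definition block :: "('e \<Rightarrow> 'e) \<Rightarrow> 'e set \<Rightarrow> 'e set \<Rightarrow> 'e set \<Rightarrow> 'e \<Rightarrow> 'e" where
  "block d W U V = restrict (\<lambda>x. component U V (d x)) W"

lemma direct_sum_commute: "direct_sum U V \<Longrightarrow> direct_sum V U"
proof -
  assume "direct_sum U V"
  moreover have "{u + v |u v. u \<in> U \<and> v \<in> V} = {v + u |v u. v \<in> V \<and> u \<in> U}"
    using add.commute by blast
  ultimately show ?thesis
    by (simp add: direct_sum_def Int_commute)
qed

lemma direct_sum_decompose:
  assumes "direct_sum U V"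
  obtains u v where "u \<in> U" "v \<in> V" "x = u + v"
proof -
  have "x \<in> {u + v |u v. u \<in> U \<and> v \<in> V}"
    using assms by (simp add: direct_sum_def)
  then show ?thesis using that by blast
qed

lemma component_add_eq:
  assumes "subspace U" "subspace V" "direct_sum U V" "u \<in> U" "v \<in> V"
  shows "component U V (u + v) = u"
  unfolding component_def
proof (rule the_equality)
  show "u \<in> U \<and> u + v - u \<in> V" using assms by simp
next
  fix w assume w: "w \<in> U \<and> u + v - w \<in> V"
  have "(u + v - w) - v \<in> V" using assms w subspace_diff by blast
  moreover have "u - w \<in> U" using assms w subspace_diff by blast
  ultimately have "u - w \<in> U \<inter> V" by (simp add: algebra_simps)
  then have "u - w = 0" using assms(3) unfolding direct_sum_def by blast
  then show "w = u" by simp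
qed

lemma component_in:
  assumes "subspace U" "subspace V" "direct_sum U V"
  shows "component U V x \<in> U"
  using direct_sum_decompose[OF assms(3), of x] component_add_eq[OF assms] by metis

lemma component_sum:
  assumes "subspace U" "subspace V" "direct_sum U V"
  shows "component U V x + component V U x = x"
proof -
  obtain u v where uv: "u \<in> U" "v \<in> V" "x = u + v"
    using direct_sum_decompose[OF assms(3)] .
  have "component V U (v + u) = v"
    using assms uv direct_sum_commute component_add_eq by blast
  then show ?thesis
    using component_add_eq[OF assms uv(1,2)] uv(3) by (simp add: add.commute)
qed

lemma component_add:
  assumes "subspace U" "subspace V" "direct_sum U V"
  shows "component U V (x + y) = component U V x + component U V y"
proof -
  let ?u = "component U V" and ?v = "component V U"
  have "?u x + ?u y \<in> U" "?v x + ?v y \<in> V"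
    using assms component_in direct_sum_commute subspace_add by blast+
  then have "?u ((?u x + ?u y) + (?v x + ?v y)) = ?u x + ?u y"
    using component_add_eq[OF assms] by blast
  moreover have "(?u x + ?u y) + (?v x + ?v y) = (?u x + ?v x) + (?u y + ?v y)"
    by (simp add: algebra_simps)
  ultimately show ?thesis by (simp only: component_sum[OF assms])
qed

lemma component_scale:
  assumes "subspace U" "subspace V" "direct_sum U V"
  shows "component U V (scale c x) = scale c (component U V x)"
proof -
  let ?u = "component U V" and ?v = "component V U"
  have "scale c (?u x) \<in> U" "scale c (?v x) \<in> V"
    using assms component_in direct_sum_commute subspace_scale by blast+
  then have "?u (scale c (?u x) + scale c (?v x)) = scale c (?u x)"
    using component_add_eq[OF assms] by blast
  then show ?thesis
    by (simp only: component_sum[OF assms] scale_right_distrib[symmetric])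
qed

lemma block_Hom:
  assumes "subspace W" "subspace U" "subspace V" "direct_sum U V" "d \<in> End UNIV"
  shows "block d W U V \<in> Hom W U"
  using assms(5) component_in[OF assms(2-4)] subspace_add[OF assms(1)] subspace_scale[OF assms(1)]
  by (simp add: Hom_def block_def component_add[OF assms(2-4)] component_scale[OF assms(2-4)])

text \<open>Values outside the domain are pinned down by extensionality, so this is an equality of
  functions.\<close>

lemma block_unique:
  assumes "subspace U" "subspace V" "direct_sum U V"
    and "f \<in> Hom W U" "h \<in> Hom W V" "\<forall>x\<in>W. d x = f x + h x"
  shows "f = block d W U V"
proof
  fix x show "f x = block d W U V x"
  proof (cases "x \<in> W")
    case True
    then have "f x \<in> U" "h x \<in> V" using assms(4,5) by (auto simp: Hom_def)
    then show ?thesis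
      using True assms(6) component_add_eq[OF assms(1-3)] by (simp add: block_def)
  next
    case False
    then have "f x = undefined" using assms(4) PiE_arb[of f W _ x] False by (auto simp: Hom_def)
    then show ?thesis using False by (simp add: block_def)
  qed
qed

section \<open>Blocks of a derivation on complementary ideals\<close>

lemma ideal_mult_in:
  assumes "ideal I"
  shows "x \<in> I \<Longrightarrow> x \<star> y \<in> I" "x \<in> I \<Longrightarrow> y \<star> x \<in> I"
  using assms mult_commute by (auto simp: ideal_def)

lemma ideals_mult_zero:
  assumes "ideal I" "ideal J" "direct_sum I J" "x \<in> I" "y \<in> J"
  shows "x \<star> y = 0"
proof -
  have "x \<star> y \<in> I \<inter> J"
    using ideal_mult_in(1)[OF assms(1,4)] ideal_mult_in(2)[OF assms(2,5)] by simp
  then show ?thesis using assms(3) unfolding direct_sum_def by blast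
qed

text \<open>The difference of the two left factors lies in \<open>I\<close>, whose products with \<open>J\<close> vanish.\<close>

lemma mult_component:
  assumes "ideal I" "ideal J" "direct_sum I J" "y \<in> J"
  shows "component J I x \<star> y = x \<star> y"
proof -
  have sub: "subspace I" "subspace J" using assms by (auto simp: ideal_def)
  have "x \<star> y = (component I J x + component J I x) \<star> y"
    using component_sum[OF sub assms(3)] by simp
  also have "\<dots> = component J I x \<star> y"
    using ideals_mult_zero[OF assms(1-3) component_in[OF sub assms(3)] assms(4)]
    by (simp add: mult_add_left)
  finally show ?thesis ..
qed

lemma derivation_mult:
  "d \<in> derivations UNIV \<Longrightarrow> d (x \<star> y) = x \<star> d y + d x \<star> y"
  by (simp add: derivations_def)

lemma derivation_zero: "d \<in> derivations UNIV \<Longrightarrow> d 0 = 0"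
proof -
  assume "d \<in> derivations UNIV"
  then have "d (0 + 0) = d 0 + d 0" unfolding derivations_def Hom_def by blast
  then show ?thesis by simp
qed

text \<open>The two terms of \<open>d (x \<star> y) = 0\<close> lie in different ideals, hence vanish separately.\<close>

lemma off_diagonal_block_annihilates:
  assumes "ideal I" "ideal J" "direct_sum I J" "d \<in> derivations UNIV" "x \<in> I" "y \<in> J"
  shows "component J I (d x) \<star> y = 0"
proof -
  have "x \<star> d y + d x \<star> y = 0"
    using derivation_mult[OF assms(4), of x y] ideals_mult_zero[OF assms(1-3,5,6)]
      derivation_zero[OF assms(4)] by simp
  then have "d x \<star> y = - (x \<star> d y)"
    by (simp add: add_eq_0_iff add.commute)
  moreover have "- (x \<star> d y) \<in> I"
    using ideal_mult_in(1)[OF assms(1,5)] assms(1) subspace_neg by (simp add: ideal_def)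
  ultimately have "d x \<star> y \<in> I \<inter> J"
    using ideal_mult_in(2)[OF assms(2,6), of "d x"] by simp
  then have "d x \<star> y = 0" using assms(3) unfolding direct_sum_def by blast
  then show ?thesis using mult_component[OF assms(1-3,6)] by simp
qed

text \<open>An ideal need not be invariant under a derivation, but on products of its elements each
  Leibniz term still has a factor in it.\<close>

lemma derivation_mult_in_ideal:
  assumes "ideal I" "d \<in> derivations UNIV" "x \<in> I" "y \<in> I"
  shows "d (x \<star> y) \<in> I"
proof -
  have "x \<star> d y \<in> I" "d x \<star> y \<in> I"
    using ideal_mult_in[OF assms(1)] assms(3,4) by blast+
  then show ?thesis
    using assms(1) subspace_add by (simp add: derivation_mult[OF assms(2)] ideal_def)
qed

lemma off_diagonal_block_Hom0:
  assumes "ideal I" "ideal J" "direct_sum I J" "d \<in> derivations UNIV"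
  shows "block d I J I \<in> Hom0 I J"
proof -
  have sub: "subspace I" "subspace J" using assms by (auto simp: ideal_def)
  have ds: "direct_sum J I" using assms(3) by (rule direct_sum_commute)
  have hom: "block d I J I \<in> Hom I J"
    using block_Hom[OF sub(1,2,1) ds] assms(4) by (simp add: derivations_def)
  have prod: "block d I J I (x \<star> y) = 0" if "x \<in> I" "y \<in> I" for x y
    using component_add_eq[OF sub(2,1) ds subspace_0[OF sub(2)]
        derivation_mult_in_ideal[OF assms(1,4) that]]
      ideal_mult_in(1)[OF assms(1) that(1)] by (simp add: block_def)
  have zero: "block d I J I 0 = 0"
    using prod[OF subspace_0 subspace_0, OF sub(1) sub(1)]
      ideals_mult_zero[OF assms(1-3) subspace_0 subspace_0, OF sub] by simp
  have "subspace {x \<in> I. block d I J I x = 0}"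
    using hom zero sub(1) by (auto simp: Hom_def subspace_def)
  then have "square I \<subseteq> {x \<in> I. block d I J I x = 0}"
    unfolding square_def using prod ideal_mult_in(1)[OF assms(1)]
    by (intro span_minimal) auto
  moreover have "block d I J I ` I \<subseteq> ann J"
    using component_in[OF sub(2,1) ds] off_diagonal_block_annihilates[OF assms]
    by (auto simp: ann_def block_def)
  ultimately show ?thesis using hom by (auto simp: Hom0_def)
qed

lemma diagonal_block_derivation:
  assumes "ideal I" "ideal J" "direct_sum I J" "d \<in> derivations UNIV"
  shows "block d I I J \<in> derivations I"
proof -
  have sub: "subspace I" "subspace J" using assms by (auto simp: ideal_def)
  have ds: "direct_sum J I" using assms(3) by (rule direct_sum_commute)
  have "block d I I J (x \<star> y) = x \<star> (block d I I J y) + (block d I I J x) \<star> y"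
    if xy: "x \<in> I" "y \<in> I" for x y
  proof -
    have "component I J (d (x \<star> y)) = d (x \<star> y)"
      using component_add_eq[OF sub assms(3) derivation_mult_in_ideal[OF assms(1,4) xy]
          subspace_0[OF sub(2)]] by simp
    also have "\<dots> = x \<star> d y + d x \<star> y"
      using assms(4) by (rule derivation_mult)
    also have "\<dots> = x \<star> (component I J (d y)) + (component I J (d x)) \<star> y"
      using mult_component[OF assms(2,1) ds] xy mult_commute by metis
    finally show ?thesis
      using xy ideal_mult_in(1)[OF assms(1)] by (simp add: block_def)
  qed
  moreover have "block d I I J \<in> End I"
    using block_Hom[OF sub(1) sub assms(3)] assms(4) by (simp add: derivations_def)
  ultimately show ?thesis by (simp add: derivations_def)
qed

lemma additive_eq_on_direct_sum:
  assumes "direct_sum U V" "d \<in> End UNIV" "d' \<in> End UNIV"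
    and "\<forall>x\<in>U. d x = d' x" "\<forall>x\<in>V. d x = d' x"
  shows "d' = d"
proof
  fix x
  obtain u v where "u \<in> U" "v \<in> V" "x = u + v"
    using direct_sum_decompose[OF assms(1)] .
  then show "d' x = d x" using assms(2-) by (simp add: Hom_def)
qed

end

section \<open>Decomposition of a derivation\<close>

theorem mainTheorem2:
  fixes scale :: "'k::field \<Rightarrow> 'e::ab_group_add \<Rightarrow> 'e"
    and mult :: "'e \<Rightarrow> 'e \<Rightarrow> 'e"
    and I1 I2 :: "'e set"
    and d :: "'e \<Rightarrow> 'e"
  assumes "CHAR('k) \<noteq> 2"
    and "evolution_algebra scale mult"
    and "comm_algebra.power_associative scale mult"
    and "comm_algebra.nil mult"
    and "comm_algebra.ideal scale mult I1" and "I1 \<noteq> {0}"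
    and "comm_algebra.ideal scale mult I2" and "I2 \<noteq> {0}"
    and "comm_algebra.direct_sum I1 I2"
    and "d \<in> comm_algebra.derivations scale mult UNIV"
  shows "(\<exists>!q. case q of (f, g, l, k) \<Rightarrow>
            f \<in> comm_algebra.End scale I1 \<and> g \<in> comm_algebra.End scale I2 \<and>
            l \<in> comm_algebra.Hom scale I1 I2 \<and> k \<in> comm_algebra.Hom scale I2 I1 \<and>
            (\<forall>x\<in>I1. d x = f x + l x) \<and>
            (\<forall>x\<in>I2. d x = g x + k x) \<and>
            f \<in> comm_algebra.derivations scale mult I1 \<and>
            g \<in> comm_algebra.derivations scale mult I2 \<and>
            l \<in> comm_algebra.Hom0 scale mult I1 I2 \<and>
            k \<in> comm_algebra.Hom0 scale mult I2 I1)
       \<and> (\<forall>f g l k. \<forall>d' \<in> comm_algebra.derivations scale mult UNIV.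
            (\<forall>x\<in>I1. d x = f x + l x \<and> d' x = f x + l x) \<and>
            (\<forall>x\<in>I2. d x = g x + k x \<and> d' x = g x + k x) \<longrightarrow> d' = d)"
proof -
  interpret comm_algebra scale mult
    using assms(2) by (simp add: evolution_algebra_def)
  note id = assms(5) assms(7) and ds = assms(9) and d = assms(10)
  have ds': "direct_sum I2 I1" using ds by (rule direct_sum_commute)
  have sub: "subspace I1" "subspace I2" using id by (auto simp: ideal_def)
  have dE: "d \<in> End UNIV" using d by (simp add: derivations_def)
  let ?f = "block d I1 I1 I2" and ?l = "block d I1 I2 I1"
  let ?g = "block d I2 I2 I1" and ?k = "block d I2 I1 I2"
  have sums: "\<forall>x\<in>I1. d x = ?f x + ?l x" "\<forall>x\<in>I2. d x = ?g x + ?k x"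
    using component_sum[OF sub ds] component_sum[OF sub(2,1) ds'] by (auto simp: block_def)
  have homs: "?f \<in> End I1" "?g \<in> End I2" "?l \<in> Hom I1 I2" "?k \<in> Hom I2 I1"
    using block_Hom sub ds ds' dE by blast+
  have uniq: "f = ?f \<and> g = ?g \<and> l = ?l \<and> k = ?k"
    if "f \<in> End I1" "g \<in> End I2" "l \<in> Hom I1 I2" "k \<in> Hom I2 I1"
      "\<forall>x\<in>I1. d x = f x + l x" "\<forall>x\<in>I2. d x = g x + k x" for f g l k
  proof -
    have "\<forall>x\<in>I1. d x = l x + f x" "\<forall>x\<in>I2. d x = k x + g x"
      using that(5,6) by (auto simp: add.commute)
    then show ?thesis
      using that block_unique[OF sub ds] block_unique[OF sub(2,1) ds'] by blast
  qed
  show ?thesis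
  proof (intro conjI allI ballI impI, goal_cases)
    case 1
    show ?case
    proof (rule ex1I[of _ "(?f, ?g, ?l, ?k)"])
      show "case (?f, ?g, ?l, ?k) of (f, g, l, k) \<Rightarrow>
            f \<in> End I1 \<and> g \<in> End I2 \<and> l \<in> Hom I1 I2 \<and> k \<in> Hom I2 I1 \<and>
            (\<forall>x\<in>I1. d x = f x + l x) \<and> (\<forall>x\<in>I2. d x = g x + k x) \<and>
            f \<in> derivations I1 \<and> g \<in> derivations I2 \<and>
            l \<in> Hom0 I1 I2 \<and> k \<in> Hom0 I2 I1"
        using homs sums diagonal_block_derivation[OF id ds d]
          diagonal_block_derivation[OF id(2,1) ds' d]
          off_diagonal_block_Hom0[OF id ds d] off_diagonal_block_Hom0[OF id(2,1) ds' d]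
        by blast
    qed (use uniq in blast)
  next
    case (2 f g l k d')
    then show ?case
      using additive_eq_on_direct_sum[OF ds dE, of d'] by (simp add: derivations_def)
  qed
qed

end
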